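(* For every positive integer $t$ there exists a constant $K_t$, depending only on $t$, such that the following holds. Let $N$ be a (not necessarily abelian) group, let $\varphi:\mathbb{Z}_2\to\mathrm{Aut}(N)$ be a group homomorphism, and let $G=N\rtimes_\varphi\mathbb{Z}_2$. Then every balanced subset of size $k\ge K_t$ of $G\setminus\{(0,0)\}$ admits an alternating parity $t$-weak sequencing.
   Context: Groups are written additively, even when non-abelian. For a group $N$ and a homomorphism $\varphi:\mathbb{Z}_2\to\mathrm{Aut}(N)$, the group $N\rtimes_\varphi\mathbb{Z}_2$ has elements $(x,a)$ with $x\in N$, $a\in\mathbb{Z}_2$, and operation $(x_1,a_1)+(x_2,a_2)=(x_1+\varphi(a_1)(x_2),\,a_1+a_2)$; its identity is $(0,0)$. Elements $(x,0)$ are called even and elements $(x,1)$ odd. A finite subset $S$ of size $k$ is balanced if $k$ is even and $S$ contains exactly $k/2$ even and $k/2$ odd elements. A $t$-weak sequencing of a set $S$ of size $k$ is an ordering $(y_1,\ldots,y_k)$ of its elements such that the partial sums $s_0=0$ and $s_i=y_1+y_2+\cdots+y_i$ ($1\le i\le k$, sums taken in this order) satisfy $s_i\neq s_j$ for all $0\le i,j\le k$ with $1\le |i-j|\le t$. It is alternating parity if even and odd elements alternate in the ordering, i.e. any two consecutive elements have different parity. *)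

theory Defs
  imports "HOL-Algebra.Algebra"
begin

text \<open>
  Groups are written multiplicatively, following HOL-Algebra; \<open>integer_mod_group 2\<close> has carrier
  \<open>{0, 1}\<close> and addition modulo 2. The action is a homomorphism
  \<open>\<phi> \<in> hom (integer_mod_group 2) (AutoGroup N)\<close>.
\<close>

definition semidirect_Z2 :: "'a monoid \<Rightarrow> (int \<Rightarrow> 'a \<Rightarrow> 'a) \<Rightarrow> ('a \<times> int) monoid" where
  "semidirect_Z2 N \<phi> =
     \<lparr>carrier = carrier N \<times> carrier (integer_mod_group 2),
      monoid.mult = (\<lambda>(x1, a1) (x2, a2). (x1 \<otimes>\<^bsub>N\<^esub> \<phi> a1 x2, a1 \<otimes>\<^bsub>integer_mod_group 2\<^esub> a2)),
      one = (\<one>\<^bsub>N\<^esub>, \<one>\<^bsub>integer_mod_group 2\<^esub>)\<rparr>"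

lemma group_semidirect_Z2:
  assumes "group N" and hom: "\<phi> \<in> hom (integer_mod_group 2) (AutoGroup N)"
  shows "group (semidirect_Z2 N \<phi>)"
proof -
  interpret N: group N by fact
  have aut: "\<phi> a \<in> auto N" if "a \<in> {0, 1}" for a
    using hom that by (auto simp: hom_def AutoGroup_def carrier_integer_mod_group)
  have Bij: "\<phi> a \<in> Bij (carrier N)" and homN: "\<phi> a \<in> hom N N" if "a \<in> {0, 1}" for a
    using aut[OF that] by (auto simp: auto_def)
  have closed: "\<phi> a x \<in> carrier N" if "a \<in> {0, 1}" "x \<in> carrier N" for a x
    using homN[OF that(1)] that(2) by (auto simp: hom_def)
  have mult: "\<phi> a (x \<otimes>\<^bsub>N\<^esub> y) = \<phi> a x \<otimes>\<^bsub>N\<^esub> \<phi> a y"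
    if "a \<in> {0, 1}" "x \<in> carrier N" "y \<in> carrier N" for a x y
    using homN[OF that(1)] that(2,3) by (auto simp: hom_def)
  have comp: "\<phi> ((a + b) mod 2) x = \<phi> a (\<phi> b x)"
    if "a \<in> {0, 1}" "b \<in> {0, 1}" "x \<in> carrier N" for a b x
  proof -
    have "\<phi> ((a + b) mod 2) = \<phi> a \<otimes>\<^bsub>AutoGroup N\<^esub> \<phi> b"
      using hom_mult[OF hom, of a b] that(1,2) by (auto simp: carrier_integer_mod_group)
    also have "\<dots> = compose (carrier N) (\<phi> a) (\<phi> b)"
      using Bij[OF that(1)] Bij[OF that(2)] by (simp add: AutoGroup_def BijGroup_def)
    finally show ?thesis using that(3) by (simp add: compose_eq)
  qed
  have zero: "\<phi> 0 x = x" if "x \<in> carrier N" for x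
  proof -
    have "inj_on (\<phi> 0) (carrier N)"
      using Bij[of 0] by (auto simp: Bij_def bij_betw_def)
    moreover have "\<phi> 0 (\<phi> 0 x) = \<phi> 0 x" using comp[of 0 0 x] that by simp
    ultimately show ?thesis using that closed[of 0 x] by (auto dest: inj_onD)
  qed
  have Z: "carrier (integer_mod_group 2) = {0, 1}"
    by (auto simp: carrier_integer_mod_group)
  show ?thesis
  proof (rule groupI)
    fix g assume g: "g \<in> carrier (semidirect_Z2 N \<phi>)"
    obtain x a where [simp]: "g = (x, a)" by (cases g)
    have xa: "x \<in> carrier N" "a \<in> {0, 1}" using g Z by (auto simp: semidirect_Z2_def)
    have "\<phi> a (inv\<^bsub>N\<^esub> x) \<otimes>\<^bsub>N\<^esub> \<phi> a x = \<one>\<^bsub>N\<^esub>"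
      using xa mult[of a "inv\<^bsub>N\<^esub> x" x] group_hom.hom_one[of N N "\<phi> a"] homN[of a] assms(1)
      by (auto simp: group_hom_def group_hom_axioms_def)
    then have "(\<phi> a (inv\<^bsub>N\<^esub> x), a) \<otimes>\<^bsub>semidirect_Z2 N \<phi>\<^esub> g = \<one>\<^bsub>semidirect_Z2 N \<phi>\<^esub>"
      using xa by (auto simp: semidirect_Z2_def)
    moreover have "(\<phi> a (inv\<^bsub>N\<^esub> x), a) \<in> carrier (semidirect_Z2 N \<phi>)"
      using xa closed Z by (simp add: semidirect_Z2_def)
    ultimately show "\<exists>h\<in>carrier (semidirect_Z2 N \<phi>).
        h \<otimes>\<^bsub>semidirect_Z2 N \<phi>\<^esub> g = \<one>\<^bsub>semidirect_Z2 N \<phi>\<^esub>" by blast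
  next
    fix f g h
    assume "f \<in> carrier (semidirect_Z2 N \<phi>)" "g \<in> carrier (semidirect_Z2 N \<phi>)"
      "h \<in> carrier (semidirect_Z2 N \<phi>)"
    then show "f \<otimes>\<^bsub>semidirect_Z2 N \<phi>\<^esub> g \<otimes>\<^bsub>semidirect_Z2 N \<phi>\<^esub> h =
        f \<otimes>\<^bsub>semidirect_Z2 N \<phi>\<^esub> (g \<otimes>\<^bsub>semidirect_Z2 N \<phi>\<^esub> h)"
      unfolding semidirect_Z2_def Z
      by (simp add: mem_Times_iff split_beta comp mult closed N.m_assoc mod_simps add.assoc)
  qed (use Z closed zero in \<open>auto simp: semidirect_Z2_def\<close>)
qed

definition even_part :: "('a \<times> int) set \<Rightarrow> ('a \<times> int) set" where
  "even_part S = {g \<in> S. snd g = 0}"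

definition odd_part :: "('a \<times> int) set \<Rightarrow> ('a \<times> int) set" where
  "odd_part S = {g \<in> S. snd g = 1}"

definition balanced :: "('a \<times> int) set \<Rightarrow> bool" where
  "balanced S \<longleftrightarrow> finite S \<and> even (card S) \<and>
     card (even_part S) = card S div 2 \<and> card (odd_part S) = card S div 2"

definition partial_prod :: "('g, 'm) monoid_scheme \<Rightarrow> 'g list \<Rightarrow> nat \<Rightarrow> 'g" where
  "partial_prod G ys i = foldl (\<otimes>\<^bsub>G\<^esub>) \<one>\<^bsub>G\<^esub> (take i ys)"

definition weak_sequencing ::
    "('g, 'm) monoid_scheme \<Rightarrow> nat \<Rightarrow> 'g set \<Rightarrow> 'g list \<Rightarrow> bool" where
  "weak_sequencing G t S ys \<longleftrightarrow> distinct ys \<and> set ys = S \<and>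
     (\<forall>i j. i \<le> length ys \<longrightarrow> j \<le> length ys \<longrightarrow>
        1 \<le> \<bar>int i - int j\<bar> \<longrightarrow> \<bar>int i - int j\<bar> \<le> int t \<longrightarrow>
        partial_prod G ys i \<noteq> partial_prod G ys j)"

definition alternating_parity :: "('a \<times> int) list \<Rightarrow> bool" where
  "alternating_parity ys \<longleftrightarrow> (\<forall>i. Suc i < length ys \<longrightarrow> snd (ys ! i) \<noteq> snd (ys ! Suc i))"

text \<open>
  The bound must depend on \<open>t\<close> alone, whereas in a statement of the form
  \<open>\<exists>K. \<forall>N :: 'a monoid. \<dots>\<close> it could also depend on the type \<open>'a\<close> of the elements (and would be
  trivial for finite \<open>'a\<close>). HOL cannot quantify over types below an existential, so the bound is
  named by a constant without type variables: \<open>sequencing_bound t\<close> is some bound valid for all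
  groups with carrier in \<open>nat\<close>. If such a bound did not exist, nothing would be known about
  \<open>sequencing_bound t\<close>; hence proving that \<open>sequencing_bound t\<close> works for all groups over an
  arbitrary type \<open>'a\<close> includes the existence of a bound (take \<open>'a = nat\<close>) and that one number
  serves all groups whatsoever. No generality depends on the choice of \<open>nat\<close>: a finite \<open>S\<close> lies
  in \<open>M \<rtimes> \<int>\<^sub>2\<close> for a countable \<open>\<phi>\<close>-invariant subgroup \<open>M\<close> of \<open>N\<close>.
\<close>

definition sequencing_bound :: "nat \<Rightarrow> nat" where
  "sequencing_bound t = (SOME K.
     \<forall>(N :: nat monoid) \<phi> S.
       group N \<longrightarrow> \<phi> \<in> hom (integer_mod_group 2) (AutoGroup N) \<longrightarrow>
       S \<subseteq> carrier (semidirect_Z2 N \<phi>) - {\<one>\<^bsub>semidirect_Z2 N \<phi>\<^esub>} \<longrightarrow>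
       balanced S \<longrightarrow> K \<le> card S \<longrightarrow>
       (\<exists>ys. weak_sequencing (semidirect_Z2 N \<phi>) t S ys \<and> alternating_parity ys))"

end

theory Submission
  imports Defs
begin

text \<open>
  The ordering only has to avoid windows of length at most \<open>t\<close> with trivial product. Filling the
  positions from left to right, each new position excludes at most \<open>t\<close> values, so the greedy choice
  works until few elements of one parity are left. To absorb these, a bounded number of early
  positions (the slots), far apart from each other, is skipped. Whether an element fits into a slot
  depends only on the \<open>t\<close> entries on either side, and each slot excludes at most \<open>(t + 1)\<^sup>2\<close> values. As the
  neighbourhoods of the slots are filled while almost all of \<open>S\<close> is still available, the sets of
  excluded values can be made disjoint for different slots. Then every leftover element is excluded
  by at most one slot, so a misplaced element can be swapped with the content of another slot
  of the same parity without spoiling anything.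
\<close>

section \<open>Greedy choice and matching\<close>

text \<open>\<open>Q f i\<close> looks at \<open>f\<close> only up to \<open>i\<close>, so fixing
  the value at a new position cannot spoil earlier ones. The default \<open>d\<close> keeps
  \<open>f\<close> total with range in \<open>D\<close> at every stage.\<close>

lemma greedy_sequence:
  fixes m :: nat and Q :: "(nat \<Rightarrow> 'b) \<Rightarrow> nat \<Rightarrow> bool"
  assumes mem: "d \<in> D"
    and cong: "\<And>f g i. (\<And>j. j \<le> i \<Longrightarrow> f j = g j) \<Longrightarrow> Q f i \<Longrightarrow> Q g i"
    and step: "\<And>f i. i < m \<Longrightarrow> range f \<subseteq> D \<Longrightarrow> (\<And>j. j < i \<Longrightarrow> Q f j) \<Longrightarrow> \<exists>x\<in>D. Q (f(i := x)) i"
  shows "\<exists>f. range f \<subseteq> D \<and> (\<forall>i<m. Q f i)"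
proof -
  have "\<exists>f. range f \<subseteq> D \<and> (\<forall>i<k. Q f i)" if "k \<le> m" for k
    using that
  proof (induction k)
    case 0
    show ?case using mem by (intro exI[of _ "\<lambda>_. d"]) auto
  next
    case (Suc k)
    then obtain f where f: "range f \<subseteq> D" "\<forall>i<k. Q f i" by auto
    then obtain x where x: "x \<in> D" "Q (f(k := x)) k" using step[of k f] Suc.prems by auto
    have "Q (f(k := x)) i" if "i < Suc k" for i
    proof (cases "i = k")
      case False
      then show ?thesis using f(2) that by (intro cong[of i f "f(k := x)"]) auto
    qed (use x in simp)
    moreover have "range (f(k := x)) \<subseteq> D" using f(1) x(1) by auto
    ultimately show ?case by blast
  qed
  then show ?thesis by blast
qed

text \<open>Positions are repaired one by one. If \<open>g p\<close> is bad for \<open>p\<close>,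
  swap it with some \<open>g q\<close> that is not bad for \<open>p\<close>; since a value is bad
  for at most one position, \<open>g p\<close> is harmless at \<open>q\<close>, even if
  \<open>q\<close> was repaired before.\<close>

lemma matching_by_swaps:
  assumes "finite P" "finite Y" "card P = card Y"
    and uniq: "\<And>p q y. \<lbrakk>p \<in> P; q \<in> P; y \<in> Y; bad p y; bad q y\<rbrakk> \<Longrightarrow> p = q"
    and good: "\<And>p. p \<in> P \<Longrightarrow> \<exists>y\<in>Y. \<not> bad p y"
  obtains g where "bij_betw g P Y" "\<And>p. p \<in> P \<Longrightarrow> \<not> bad p (g p)"
proof -
  have "\<exists>g. bij_betw g P Y \<and> (\<forall>p\<in>Q. \<not> bad p (g p))" if "Q \<subseteq> P" for Q
    using finite_subset[OF that assms(1)] that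
  proof (induction Q rule: finite_induct)
    case empty
    show ?case using finite_same_card_bij[OF assms(1-3)] by auto
  next
    case (insert p Q)
    then obtain g where g: "bij_betw g P Y" "\<forall>q\<in>Q. \<not> bad q (g q)" by auto
    show ?case
    proof (cases "bad p (g p)")
      case True
      obtain y where "y \<in> Y" "\<not> bad p y" using good insert.prems by auto
      then obtain q where q: "q \<in> P" "\<not> bad p (g q)"
        using g(1) by (metis bij_betw_iff_bijections)
      have p: "p \<in> P" "p \<noteq> q" using insert.prems True q by auto
      let ?g = "g \<circ> transpose p q"
      have "bij_betw ?g P Y"
        using bij_betw_trans[OF _ g(1), of "transpose p q" P] p q
        by (metis bij_betw_transpose_iff)
      moreover have "\<not> bad r (?g r)" if "r \<in> insert p Q" for r
      proof -
        have "\<not> bad q (g p)" using uniq[OF p(1) q(1) _ True] p g(1) by (auto simp: bij_betw_def)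
        then show ?thesis using that q g(2) p insert.hyps
          by (auto simp: transpose_def)
      qed
      ultimately show ?thesis by blast
    qed (use g in auto)
  qed
  from this[of P] show ?thesis using that by auto
qed

text \<open>Counts the values lost in a greedy step: each constraint \<open>a\<close> determines at
  most one forbidden value, so choosing that value maps \<open>A\<close> onto a superset of all of
  them.\<close>

lemma card_at_most_one_each:
  assumes "finite A" and "\<And>a x y. \<lbrakk>a \<in> A; R a x; R a y\<rbrakk> \<Longrightarrow> x = y"
  shows "finite {x. \<exists>a\<in>A. R a x}" "card {x. \<exists>a\<in>A. R a x} \<le> card A"
proof -
  have sub: "{x. \<exists>a\<in>A. R a x} \<subseteq> (\<lambda>a. THE x. R a x) ` A"
  proof
    fix x assume "x \<in> {x. \<exists>a\<in>A. R a x}"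
    then obtain a where a: "a \<in> A" "R a x" by auto
    then have "(THE x. R a x) = x" using assms(2) by (intro the_equality) auto
    then show "x \<in> (\<lambda>a. THE x. R a x) ` A" using a by force
  qed
  show "finite {x. \<exists>a\<in>A. R a x}" using finite_subset[OF sub] assms(1) by auto
  show "card {x. \<exists>a\<in>A. R a x} \<le> card A"
    using card_mono[OF _ sub] card_image_le[OF assms(1)] assms(1) by (meson finite_imageI le_trans)
qed

text \<open>Each step of the induction adds one of \<open>2 * n\<close> and
  \<open>2 * n + 1\<close>. The shift \<open>s\<close> serves the slots, whose parity is that of
  their index plus \<open>t\<close>.\<close>

lemma card_residue_class_2:
  assumes "c < (2::nat)"
  shows "card {i. i < 2 * n \<and> (i + s) mod 2 = c} = n"
proof (induction n)
  case (Suc n)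
  define b where "b = (if s mod 2 = c then 2 * n else Suc (2 * n))"
  have "i < 2 * Suc n \<and> (i + s) mod 2 = c \<longleftrightarrow> i = b \<or> i < 2 * n \<and> (i + s) mod 2 = c" for i
  proof -
    have "i < 2 * Suc n \<longleftrightarrow> i = 2 * n \<or> i = Suc (2 * n) \<or> i < 2 * n" by auto
    moreover have "(2 * n + s) mod 2 = s mod 2" "(Suc (2 * n) + s) mod 2 = (if s mod 2 = 0 then 1 else 0)"
      by (simp_all add: mod_Suc)
    ultimately show ?thesis using assms unfolding b_def by (cases "s mod 2 = 0") auto
  qed
  then have "{i. i < 2 * Suc n \<and> (i + s) mod 2 = c} = insert b {i. i < 2 * n \<and> (i + s) mod 2 = c}"
    by auto
  moreover have "b \<notin> {i. i < 2 * n \<and> (i + s) mod 2 = c}" by (auto simp: b_def)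
  ultimately show ?case using Suc by simp
qed simp

section \<open>Window products\<close>

text \<open>Fillings are total functions on positions rather than lists, so that slots can stay open
  and single entries can be changed by \<open>f(i := x)\<close>.\<close>

primrec seg_prod :: "('g, 'm) monoid_scheme \<Rightarrow> (nat \<Rightarrow> 'g) \<Rightarrow> nat \<Rightarrow> nat \<Rightarrow> 'g" where
  "seg_prod G f a 0 = \<one>\<^bsub>G\<^esub>"
| "seg_prod G f a (Suc l) = seg_prod G f a l \<otimes>\<^bsub>G\<^esub> f (a + l)"

text \<open>The value at position \<open>p\<close> that makes the product over \<open>{p - i..p + j}\<close> trivial.\<close>

definition hole_value ::
    "('g, 'm) monoid_scheme \<Rightarrow> (nat \<Rightarrow> 'g) \<Rightarrow> nat \<Rightarrow> nat \<Rightarrow> nat \<Rightarrow> 'g" where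
  "hole_value G f p i j = inv\<^bsub>G\<^esub> (seg_prod G f (p - i) i) \<otimes>\<^bsub>G\<^esub> inv\<^bsub>G\<^esub> (seg_prod G f (Suc p) j)"

lemma seg_prod_cong:
  "(\<And>i. a \<le> i \<Longrightarrow> i < a + l \<Longrightarrow> f i = g i) \<Longrightarrow> seg_prod G f a l = seg_prod G g a l"
  by (induction l) auto

text \<open>Both segments skip \<open>p\<close>, so the content of a slot has no influence on its
  own forbidden values.\<close>

lemma hole_value_cong:
  assumes "\<And>q. p - i \<le> q \<Longrightarrow> q \<le> p + j \<Longrightarrow> q \<noteq> p \<Longrightarrow> f q = g q" "i \<le> p"
  shows "hole_value G f p i j = hole_value G g p i j"
proof -
  have "seg_prod G f (p - i) i = seg_prod G g (p - i) i"
    "seg_prod G f (Suc p) j = seg_prod G g (Suc p) j"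
    using assms by (auto intro!: seg_prod_cong)
  then show ?thesis by (simp add: hole_value_def)
qed

lemma partial_prod_map_upt:
  "i \<le> k \<Longrightarrow> partial_prod G (map f [0..<k]) i = seg_prod G f 0 i"
  by (induction i) (auto simp: partial_prod_def take_Suc_conv_app_nth)

context group
begin

lemma seg_prod_closed [simp]: "range f \<subseteq> carrier G \<Longrightarrow> seg_prod G f a l \<in> carrier G"
  by (induction l) auto

lemma seg_prod_add:
  assumes "range f \<subseteq> carrier G"
  shows "seg_prod G f a (l + m) = seg_prod G f a l \<otimes> seg_prod G f (a + l) m"
  using assms by (induction m) (auto simp: m_assoc add.assoc range_subsetD)

lemma inv_equality_iff: "x \<in> carrier G \<Longrightarrow> y \<in> carrier G \<Longrightarrow> inv x = inv y \<longleftrightarrow> x = y"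
  by (metis inv_inv)

text \<open>Splitting the window at \<open>p\<close> turns the assumption into an equation u x v = 1
  for x = \<open>f p\<close>, with the only solution \<open>inv u \<otimes> inv v\<close>.\<close>

lemma eq_hole_value:
  assumes f: "range f \<subseteq> carrier G" and "i \<le> p" and 1: "seg_prod G f (p - i) (Suc (i + j)) = \<one>"
  shows "f p = hole_value G f p i j"
proof -
  let ?a = "seg_prod G f (p - i) i" and ?b = "seg_prod G f (Suc p) j"
  have c: "?a \<in> carrier G" "?b \<in> carrier G" "f p \<in> carrier G" using f by auto
  have "seg_prod G f (p - i) (Suc (i + j)) = seg_prod G f (p - i) (Suc i) \<otimes> ?b"
    using seg_prod_add[OF f, of "p - i" "Suc i" j] assms(2) by simp
  then have "?a \<otimes> f p \<otimes> ?b = \<one>" using 1 assms(2) by simp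
  then have "?a \<otimes> f p = inv ?b" using c by (metis inv_equality m_closed)
  then show ?thesis using c by (simp add: hole_value_def inv_solve_left)
qed

text \<open>Position \<open>q\<close> is the last factor of exactly one of the two segments and does
  not occur in the other, so cancellation recovers its entry. For \<open>(i, j) = (0, 0)\<close>
  both segments are empty and the hole value is constantly 1.\<close>

lemma hole_value_update_inj:
  assumes f: "range f \<subseteq> carrier G" and x: "x \<in> carrier G" "y \<in> carrier G"
    and "i \<le> p" "(i, j) \<noteq> (0, 0)" and q: "q = (if j = 0 then p - 1 else p + j)"
    and eq: "hole_value G (f(q := x)) p i j = hole_value G (f(q := y)) p i j"
  shows "x = y"
proof (cases j)
  case 0
  then obtain i' where i: "i = Suc i'" using assms(5) by (cases i) auto
  have q': "q = p - Suc i' + i'" using q 0 assms(4) i by simp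
  have *: "hole_value G (f(q := z)) p i j = inv (seg_prod G f (p - i) i' \<otimes> z)" if "z \<in> carrier G" for z
  proof -
    have "seg_prod G (f(q := z)) (p - i) i' = seg_prod G f (p - i) i'"
      by (rule seg_prod_cong) (auto simp: q' i)
    then show ?thesis using f that by (simp add: hole_value_def 0 i q')
  qed
  have "seg_prod G f (p - i) i' \<otimes> x = seg_prod G f (p - i) i' \<otimes> y"
    using eq f x by (simp add: * inv_equality_iff)
  then show ?thesis using f x by simp
next
  case (Suc j')
  have q': "q = Suc (p + j')" using q Suc by simp
  have *: "hole_value G (f(q := z)) p i j = inv (seg_prod G f (p - i) i) \<otimes> inv (seg_prod G f (Suc p) j' \<otimes> z)"
    if "z \<in> carrier G" for z
  proof -
    have "seg_prod G (f(q := z)) (Suc p) j' = seg_prod G f (Suc p) j'"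
      "seg_prod G (f(q := z)) (p - i) i = seg_prod G f (p - i) i"
      using assms(4) by (auto simp: q' intro!: seg_prod_cong)
    then show ?thesis by (simp add: hole_value_def Suc q')
  qed
  have "seg_prod G f (Suc p) j' \<otimes> x = seg_prod G f (Suc p) j' \<otimes> y"
    using eq f x by (simp add: * inv_equality_iff)
  then show ?thesis using f x by simp
qed

end

section \<open>Arrangements in a group\<close>

text \<open>
  The spacing \<open>2 * t + 1\<close> keeps the \<open>t\<close>-neighbourhoods of the slots disjoint; it is odd, so that
  consecutive slots have different parity.
\<close>

definition slots :: "nat \<Rightarrow> nat \<Rightarrow> nat set" where
  "slots t m = (\<lambda>j. j * (2 * t + 1) + t) ` {..<m}"

lemma finite_slots [simp]: "finite (slots t m)" and card_slots_le: "card (slots t m) \<le> m"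
  using card_image_le[of "{..<m}" "\<lambda>j. j * (2 * t + 1) + t"] by (auto simp: slots_def)

text \<open>Each slot is the centre of a block of \<open>2 * t + 1\<close> positions, so its
  \<open>t\<close>-neighbourhood stays within the first \<open>m\<close> blocks.\<close>

lemma slots_bounds:
  assumes "p \<in> slots t m"
  shows "t \<le> p" "p + t < m * (2 * t + 1)"
proof -
  obtain j where j: "j < m" "p = j * (2 * t + 1) + t" using assms by (auto simp: slots_def)
  have "Suc j * (2 * t + 1) \<le> m * (2 * t + 1)" using j(1) by (intro mult_le_mono1) simp
  then show "t \<le> p" "p + t < m * (2 * t + 1)" using j(2) by auto
qed

lemma slots_separated:
  assumes "p \<in> slots t m" "q \<in> slots t m" "p < q"
  shows "p + 2 * t < q"
proof -
  obtain i j where j: "p = i * (2 * t + 1) + t" "q = j * (2 * t + 1) + t"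
    using assms by (auto simp: slots_def)
  then have "i < j" using assms(3) by (metis add_less_cancel_right mult_less_cancel2)
  then have "Suc i * (2 * t + 1) \<le> j * (2 * t + 1)" by (intro mult_le_mono1) simp
  then show ?thesis using j by auto
qed

text \<open>Ensures that the hole values of a slot within reach \<open>t\<close> are determined by
  filled positions alone.\<close>

lemma near_slot_not_slot:
  assumes "p \<in> slots t m" "i \<noteq> p" "i \<le> p + t" "p \<le> i + t"
  shows "i \<notin> slots t m"
  using slots_separated[OF assms(1), of i] slots_separated[of i t m p] assms
  by (cases i p rule: linorder_cases) auto

text \<open>As \<open>2 * t + 1\<close> is odd, slot number \<open>j\<close> has the parity of
  \<open>j + t\<close>, so half of the slots fall to each parity.\<close>

lemma card_slots_parity:
  assumes "c < 2"
  shows "card {p \<in> slots t (2 * m). p mod 2 = c} = m"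
proof -
  have "(j * (2 * t + 1) + t) mod 2 = (j + t) mod 2" for j
  proof -
    have "j * (2 * t + 1) + t = j + t + 2 * (j * t)" by (simp add: algebra_simps)
    then show ?thesis by (metis mod_mult_self2)
  qed
  then have "{p \<in> slots t (2 * m). p mod 2 = c} =
      (\<lambda>j. j * (2 * t + 1) + t) ` {j. j < 2 * m \<and> (j + t) mod 2 = c}"
    by (auto simp: slots_def)
  moreover have "inj_on (\<lambda>j. j * (2 * t + 1) + t) Z" for Z
    by (rule inj_onI) (metis add_right_cancel mult_cancel2 Suc_eq_plus1 nat.distinct(1))
  ultimately show ?thesis
    using card_residue_class_2[OF assms, of m t] by (simp only: card_image)
qed

text \<open>The number of slots of each parity: one more than the number of pairs of reaches up to
  \<open>t\<close>, so that the leftover elements outnumber the forbidden values of any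
  slot.\<close>

definition slot_count :: "nat \<Rightarrow> nat" where
  "slot_count t = Suc ((t + 1)\<^sup>2)"

text \<open>The three summands bound what an early position has to avoid: entries already placed,
  values closing a trivial window, and values making forbidden values of two slots coincide.\<close>

definition arrangement_bound :: "nat \<Rightarrow> nat" where
  "arrangement_bound t = 2 * slot_count t * (2 * t + 1) + t + (2 * slot_count t)\<^sup>2 * (t + 1) ^ 4"

text \<open>
  Windows meeting a slot involve arbitrary values of \<open>f\<close> there; the condition on them is harmless.
\<close>

lemma (in group) partial_arrangement:
  fixes A :: "nat \<Rightarrow> 'a set" and t n :: nat
  defines "P \<equiv> slots t (2 * slot_count t)"
  assumes A: "A 0 \<subseteq> carrier G - {\<one>}" "A 1 \<subseteq> carrier G - {\<one>}" "card (A 0) = n" "card (A 1) = n"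
    and disj: "A 0 \<inter> A 1 = {}" and n: "arrangement_bound t < n"
  shows "\<exists>f. range f \<subseteq> carrier G \<and> inj_on f ({..<2 * n} - P) \<and>
    (\<forall>i\<in>{..<2 * n} - P. f i \<in> A (i mod 2)) \<and>
    (\<forall>i\<in>{..<2 * n} - P. \<forall>l\<le>i. l < t \<longrightarrow> seg_prod G f (i - l) (Suc l) \<noteq> \<one>) \<and>
    (\<forall>p\<in>P. \<forall>q\<in>P. \<forall>a\<le>t. \<forall>b\<le>t. \<forall>a'\<le>t. \<forall>b'\<le>t. q < p \<longrightarrow> (a, b) \<noteq> (0, 0) \<longrightarrow>
      hole_value G f p a b \<noteq> hole_value G f q a' b')"
proof -
  define T where "T = 2 * slot_count t * (2 * t + 1)"
  \<comment> \<open>A tuple names a possible coincidence between a hole value of slot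
    \<open>p\<close> and one of slot \<open>q\<close>.\<close>
  define Par where "Par = P \<times> {..t} \<times> {..t} \<times> P \<times> {..t} \<times> {..t}"
  have nT: "T + t + (2 * slot_count t)\<^sup>2 * (t + 1) ^ 4 < n"
    using n by (simp add: arrangement_bound_def T_def)
  have sub: "A c \<subseteq> carrier G - {\<one>}" and card_A: "card (A c) = n" if "c < 2" for c
    using A less_2_cases[OF that] by auto
  have finP: "finite P" by (simp add: P_def)
  have bnd: "t \<le> p" "p + t < T" if "p \<in> P" for p
    using slots_bounds[of p t "2 * slot_count t"] that unfolding P_def T_def by blast+
  have sep: "q + 2 * t < p" if "p \<in> P" "q \<in> P" "q < p" for p q
    using slots_separated that by (auto simp: P_def)
  have card_Par: "finite Par" "card Par \<le> (2 * slot_count t)\<^sup>2 * (t + 1) ^ 4"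
  proof -
    have "card Par = (card P)\<^sup>2 * (t + 1) ^ 4"
      by (simp add: Par_def card_cartesian_product power2_eq_square power4_eq_xxxx algebra_simps)
    also have "\<dots> \<le> (2 * slot_count t)\<^sup>2 * (t + 1) ^ 4"
      using card_slots_le unfolding P_def by (intro mult_le_mono1 power_mono) auto
    finally show "card Par \<le> (2 * slot_count t)\<^sup>2 * (t + 1) ^ 4" .
  qed (simp add: Par_def finP)
  \<comment> \<open>the last position to be filled among those that \<open>hole_value G f p a b\<close> depends on\<close>
  define last where "last p b = (if b = 0 then p - 1 else p + b)" for p b :: nat
  \<comment> \<open>A coincidence is tested at \<open>last p b\<close>: by then every entry involved
    is placed, and the choice there can still break it.\<close>
  define C where "C f i = (\<lambda>(p, a, b, q, a', b'). q < p \<and> (a, b) \<noteq> (0, 0) \<and> i = last p b \<and>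
      hole_value G f p a b = hole_value G f q a' b')" for f :: "nat \<Rightarrow> 'a" and i :: nat
  \<comment> \<open>Every condition is charged to its last position; windows ending at
    \<open>i\<close> have length \<open>Suc l\<close>, at most \<open>t\<close>. Slots satisfy
    \<open>Q\<close> outright and do not count for distinctness.\<close>
  define Q where "Q f i \<longleftrightarrow> i \<in> P \<or> (f i \<in> A (i mod 2) \<and> (\<forall>j<i. j \<notin> P \<longrightarrow> f j \<noteq> f i) \<and>
      (\<forall>l<t. l \<le> i \<longrightarrow> seg_prod G f (i - l) (Suc l) \<noteq> \<one>) \<and> (\<forall>\<pi>\<in>Par. \<not> C f i \<pi>))"
    for f :: "nat \<Rightarrow> 'a" and i :: nat
  \<comment> \<open>By the spacing, the neighbourhood of the earlier slot \<open>q\<close> lies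
    strictly before \<open>last p b\<close>, so the choice made there can only move the hole value
    of \<open>p\<close>.\<close>
  have far: "hole_value G f q a' b' = hole_value G g q a' b'"
    if "\<And>j. j < last p b \<Longrightarrow> f j = g j" "p \<in> P" "q \<in> P" "q < p" "a' \<le> t" "b' \<le> t" for f g p q b a' b'
  proof (rule hole_value_cong)
    show "a' \<le> q" using that bnd(1)[of q] by simp
    fix j assume "q - a' \<le> j" "j \<le> q + b'" "j \<noteq> q"
    then have "j < last p b" using that sep[of p q] by (auto simp: last_def)
    then show "f j = g j" by (rule that(1))
  qed
  have C_cong: "C f i \<pi> = C g i \<pi>" if fg: "\<And>j. j \<le> i \<Longrightarrow> f j = g j" and "\<pi> \<in> Par" for f g i \<pi>
  proof -
    obtain p a b q a' b' where \<pi>: "\<pi> = (p, a, b, q, a', b')" by (cases \<pi>) auto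
    have m: "p \<in> P" "a \<le> t" "b \<le> t" "q \<in> P" "a' \<le> t" "b' \<le> t" using that(2) by (auto simp: \<pi> Par_def)
    have "hole_value G f p a b = hole_value G g p a b \<and> hole_value G f q a' b' = hole_value G g q a' b'"
      if "i = last p b" "q < p"
    proof
      show "hole_value G f p a b = hole_value G g p a b"
        using bnd[of p] m that fg by (intro hole_value_cong) (auto simp: last_def split: if_splits)
      show "hole_value G f q a' b' = hole_value G g q a' b'"
        using far[of p b f g q a' b'] m that fg by auto
    qed
    then show ?thesis by (auto simp: \<pi> C_def)
  qed
  have step: "\<exists>x\<in>carrier G. Q (f(i := x)) i"
    if i: "i < 2 * n" and f: "range f \<subseteq> carrier G" and IH: "\<And>j. j < i \<Longrightarrow> Q f j" for f i
  proof (cases "i \<in> P")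
    case False
    \<comment> \<open>Three kinds of values are avoided at \<open>i\<close>: entries at
      \<open>J\<close>, where only the same parity matters because the two classes are disjoint;
      \<open>B\<close>, which closes a trivial window; \<open>D\<close>, which creates a
      coincidence.\<close>
    define J where "J = {j. j < i \<and> j \<notin> P \<and> j mod 2 = i mod 2}"
    define R where "R = (\<lambda>l x. x \<in> carrier G \<and> l \<le> i \<and> seg_prod G (f(i := x)) (i - l) (Suc l) = \<one>)"
    define B where "B = {x. \<exists>l\<in>{..<t}. R l x}"
    define D where "D = {x. \<exists>\<pi>\<in>Par. x \<in> carrier G \<and> C (f(i := x)) i \<pi>}"
    have B: "finite B" "card B \<le> t"
    proof -
      have uniq: "x = y" if "R l x" "R l y" for l x y
      proof -
        have *: "seg_prod G (f(i := z)) (i - l) l = seg_prod G f (i - l) l" for z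
          using that by (intro seg_prod_cong) (auto simp: R_def)
        have "l \<le> i" using that by (simp add: R_def)
        then have "seg_prod G f (i - l) l \<otimes> x = seg_prod G f (i - l) l \<otimes> y"
          using that by (simp add: R_def *)
        then show ?thesis using that f by (simp add: R_def)
      qed
      show "finite B" "card B \<le> t"
        using card_at_most_one_each[of "{..<t}" R] uniq by (auto simp: B_def)
    qed
    have D: "finite D" "card D \<le> card Par"
    proof -
      have uniq: "x = y" if xy: "\<pi> \<in> Par" "x \<in> carrier G" "C (f(i := x)) i \<pi>"
          "y \<in> carrier G" "C (f(i := y)) i \<pi>" for \<pi> x y
      proof -
        obtain p a b q a' b' where \<pi>: "\<pi> = (p, a, b, q, a', b')" by (cases \<pi>) auto
        have m: "p \<in> P" "a \<le> t" "b \<le> t" "q \<in> P" "a' \<le> t" "b' \<le> t" using xy(1) by (auto simp: \<pi> Par_def)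
        have c: "q < p" "(a, b) \<noteq> (0, 0)" "i = last p b" using xy(3) by (auto simp: \<pi> C_def)
        have "hole_value G (f(i := x)) q a' b' = hole_value G (f(i := y)) q a' b'"
          using m c by (intro far[of p b]) auto
        then have "hole_value G (f(i := x)) p a b = hole_value G (f(i := y)) p a b"
          using xy by (auto simp: \<pi> C_def)
        then show ?thesis
          using hole_value_update_inj[OF f xy(2,4), of a p b i] m c bnd[of p]
          by (auto simp: last_def)
      qed
      show "finite D" "card D \<le> card Par"
        using card_at_most_one_each[OF card_Par(1), of "\<lambda>\<pi> x. x \<in> carrier G \<and> C (f(i := x)) i \<pi>"] uniq
        by (auto simp: D_def)
    qed
    have finJ: "finite J" by (simp add: J_def)
    \<comment> \<open>Before \<open>T\<close> few entries are placed and \<open>n\<close> is large.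
      From \<open>T\<close> on, all coincidences have been tested, so \<open>D\<close> is empty, and
      the open slots of the parity of \<open>i\<close> hold back more than \<open>t\<close>
      elements.\<close>
    have "card J + t + card D < n"
    proof (cases "i < T")
      case True
      have "J \<subseteq> {..<i}" by (auto simp: J_def)
      from card_mono[OF _ this] have "card J \<le> i" by simp
      then show ?thesis using True nT D(2) card_Par(2) by linarith
    next
      case late: False
      have "D = {}"
      proof (rule ccontr)
        assume "D \<noteq> {}"
        then obtain p b where "p \<in> P" "b \<le> t" "i = last p b"
          by (auto simp: D_def C_def Par_def)
        then show False using late bnd[of p] by (auto simp: last_def split: if_splits)
      qed
      let ?E = "{j. j < 2 * n \<and> (j + 0) mod 2 = i mod 2}"
      \<comment> \<open>Positions of the parity of \<open>i\<close> that are surely outside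
        \<open>J\<close>.\<close>
      let ?F = "insert i {p \<in> P. p mod 2 = i mod 2}"
      have FE: "?F \<subseteq> ?E" using bnd i nT by fastforce
      have F: "finite ?F" "card ?F = Suc (slot_count t)"
        using False finP card_slots_parity[of "i mod 2" t "slot_count t"] by (simp_all add: P_def)
      have E: "finite ?E" "card ?E = n" using card_residue_class_2[of "i mod 2" n 0] by simp_all
      have "J \<subseteq> ?E - ?F" using i by (auto simp: J_def)
      then have "card J \<le> card (?E - ?F)" using E(1) by (intro card_mono) blast
      also have "\<dots> = n - Suc (slot_count t)" using card_Diff_subset[OF F(1) FE] F(2) E(2) by simp
      finally have "card J \<le> n - Suc (slot_count t)" .
      moreover have "Suc (slot_count t) \<le> n" using card_mono[OF E(1) FE] F(2) E(2) by simp
      moreover have "t < slot_count t" by (simp add: slot_count_def power2_eq_square)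
      ultimately show ?thesis using \<open>D = {}\<close> by simp
    qed
    moreover have "card (f ` J \<union> B \<union> D) \<le> card J + t + card D"
      using card_Un_le[of "f ` J \<union> B" D] card_Un_le[of "f ` J" B] card_image_le[OF finJ, of f] B(2)
      by linarith
    ultimately have "\<not> A (i mod 2) \<subseteq> f ` J \<union> B \<union> D"
      using card_mono[of "f ` J \<union> B \<union> D" "A (i mod 2)"] card_A[of "i mod 2"] finJ B(1) D(1) by auto
    then obtain x where x: "x \<in> A (i mod 2)" "x \<notin> f ` J" "x \<notin> B" "x \<notin> D" by auto
    have xc: "x \<in> carrier G" using x(1) sub[of "i mod 2"] by auto
    have "f j \<noteq> x" if "j < i" "j \<notin> P" for j
    proof (cases "j mod 2 = i mod 2")
      case True
      then show ?thesis using x(2) that by (auto simp: J_def)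
    next
      case False
      have "f j \<in> A (j mod 2)" using IH[OF that(1)] that(2) by (simp add: Q_def)
      then show ?thesis
        using False x(1) disj by (cases "even i"; cases "even j") (auto simp: mod2_eq_if)
    qed
    then have "Q (f(i := x)) i" using x xc by (auto simp: Q_def B_def D_def R_def)
    then show ?thesis using xc by blast
  qed (auto simp: Q_def)
  have Q_cong: "Q g i" if fg: "\<And>j. j \<le> i \<Longrightarrow> f j = g j" and "Q f i" for f g i
  proof -
    have "seg_prod G f (i - l) (Suc l) = seg_prod G g (i - l) (Suc l)" if "l \<le> i" for l
      using that fg by (intro seg_prod_cong) auto
    moreover have "C f i \<pi> = C g i \<pi>" if "\<pi> \<in> Par" for \<pi>
      by (rule C_cong[OF fg that])
    ultimately show ?thesis using \<open>Q f i\<close> fg unfolding Q_def by simp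
  qed
  obtain f where f: "range f \<subseteq> carrier G" "\<And>i. i < 2 * n \<Longrightarrow> Q f i"
    using greedy_sequence[of \<one> "carrier G" Q "2 * n"] Q_cong step one_closed by metis
  show ?thesis
  proof (intro exI[of _ f] conjI ballI allI impI)
    show "range f \<subseteq> carrier G" by (rule f(1))
    show "inj_on f ({..<2 * n} - P)"
      by (rule linorder_inj_onI') (use f(2) in \<open>auto simp: Q_def\<close>)
    show "hole_value G f p a b \<noteq> hole_value G f q a' b'"
      if m: "p \<in> P" "q \<in> P" "q < p" "a \<le> t" "b \<le> t" "a' \<le> t" "b' \<le> t" "(a, b) \<noteq> (0, 0)" for p q a b a' b'
    proof -
      \<comment> \<open>At a slot \<open>Q\<close> would say nothing, so the testing position has to
        be a filled one.\<close>
      have "last p b \<notin> P"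
        using near_slot_not_slot[of p t _ "last p b"] m bnd[of p] by (auto simp: P_def last_def)
      moreover have "last p b < 2 * n" using bnd[of p] m nT by (auto simp: last_def)
      ultimately have "\<not> C f (last p b) (p, a, b, q, a', b')"
        using f(2)[of "last p b"] m by (auto simp: Q_def Par_def)
      then show ?thesis using m by (auto simp: C_def)
    qed
  qed (use f(2) in \<open>auto simp: Q_def\<close>)
qed

text \<open>The elements left over by the partial arrangement are matched with the slots of their
  parity. No value is bad for two slots, and each slot has fewer bad values than there are
  leftovers, so swapping succeeds.\<close>

lemma (in group) alternating_arrangement:
  fixes A :: "nat \<Rightarrow> 'a set" and t n :: nat
  assumes A: "A 0 \<subseteq> carrier G - {\<one>}" "A 1 \<subseteq> carrier G - {\<one>}" "card (A 0) = n" "card (A 1) = n"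
    and disj: "A 0 \<inter> A 1 = {}" and n: "arrangement_bound t < n"
  shows "\<exists>h. range h \<subseteq> carrier G \<and> bij_betw h {..<2 * n} (A 0 \<union> A 1) \<and>
    (\<forall>i<2 * n. h i \<in> A (i mod 2)) \<and>
    (\<forall>a l. 0 < l \<longrightarrow> l \<le> t \<longrightarrow> a + l \<le> 2 * n \<longrightarrow> seg_prod G h a l \<noteq> \<one>)"
proof -
  define P where "P = slots t (2 * slot_count t)"
  obtain f where f: "range f \<subseteq> carrier G" "inj_on f ({..<2 * n} - P)"
      "\<forall>i\<in>{..<2 * n} - P. f i \<in> A (i mod 2)"
    and win': "\<forall>i\<in>{..<2 * n} - P. \<forall>l\<le>i. l < t \<longrightarrow> seg_prod G f (i - l) (Suc l) \<noteq> \<one>"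
    and holes': "\<forall>p\<in>P. \<forall>q\<in>P. \<forall>a\<le>t. \<forall>b\<le>t. \<forall>a'\<le>t. \<forall>b'\<le>t. q < p \<longrightarrow> (a, b) \<noteq> (0, 0) \<longrightarrow>
      hole_value G f p a b \<noteq> hole_value G f q a' b'"
    using partial_arrangement[OF A disj n, folded P_def] by (elim exE conjE) (rule that)
  have win: "seg_prod G f (i - l) (Suc l) \<noteq> \<one>" if "i \<in> {..<2 * n} - P" "l < t" "l \<le> i" for i l
    using win' that by blast
  have holes: "hole_value G f p a b \<noteq> hole_value G f q a' b'"
    if "p \<in> P" "q \<in> P" "q < p" "a \<le> t" "b \<le> t" "a' \<le> t" "b' \<le> t" "(a, b) \<noteq> (0, 0)" for p q a b a' b'
    using holes' that by blast
  have sub: "A c \<subseteq> carrier G - {\<one>}" and card_A: "card (A c) = n" if "c < 2" for c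
    using A less_2_cases[OF that] by auto
  have fin: "finite (A c)" if "c < 2" for c
    by (rule card_ge_0_finite) (use card_A[OF that] n in simp)
  have finP: "finite P" by (simp add: P_def)
  have bnd: "t \<le> p" "p < 2 * n" if "p \<in> P" for p
    using slots_bounds[of p t "2 * slot_count t"] that n unfolding P_def arrangement_bound_def by linarith+
  \<comment> \<open>The pair \<open>(0, 0)\<close> is left out: its hole value is 1 at every slot,
    which would destroy disjointness, and 1 does not lie in the sets \<open>A c\<close> in any
    case.\<close>
  define bad where "bad p y \<longleftrightarrow> (\<exists>a\<le>t. \<exists>b\<le>t. (a, b) \<noteq> (0, 0) \<and> y = hole_value G f p a b)" for p y
  define S where "S c = {p \<in> P. p mod 2 = c}" for c
  \<comment> \<open>The summand 0 fits the set to \<open>card_residue_class_2\<close>.\<close>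
  define E where "E c = {i. i < 2 * n \<and> (i + 0) mod 2 = c}" for c
  define L where "L c = A c - f ` (E c - S c)" for c
  have SE: "S c \<subseteq> E c" for c using bnd by (auto simp: S_def E_def)
  have finSE: "finite (S c)" "finite (E c)" for c by (auto simp: S_def E_def finP)
  have card_SE: "card (S c) = slot_count t" "card (E c) = n" if "c < 2" for c
    using card_slots_parity[OF that] card_residue_class_2[OF that] by (simp_all only: S_def E_def P_def)
  have inj: "inj_on f (E c - S c)" for c by (rule inj_on_subset[OF f(2)]) (auto simp: E_def S_def)
  have fA: "f ` (E c - S c) \<subseteq> A c" for c using f(3) by (auto simp: E_def S_def)
  have card_L: "card (L c) = card (S c)" if "c < 2" for c
  proof -
    have "card (f ` (E c - S c)) = n - slot_count t"
      using card_SE[OF that] finSE SE[of c] by (simp add: card_image[OF inj] card_Diff_subset)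
    moreover have "slot_count t \<le> n" using card_SE[OF that] card_mono[OF finSE(2) SE[of c]] by simp
    ultimately show ?thesis
      using fA[of c] card_A[OF that] finSE card_SE[OF that] by (simp add: L_def card_Diff_subset)
  qed
  have uniq: "p = q" if "p \<in> P" "q \<in> P" "bad p y" "bad q y" for p q y
    using that holes[of p q] holes[of q p] unfolding bad_def
    by (cases p q rule: linorder_cases) metis+
  have few: "finite {y. bad p y}" "card {y. bad p y} < slot_count t" for p
  proof -
    have sub: "{y. bad p y} \<subseteq> (\<lambda>(a, b). hole_value G f p a b) ` ({..t} \<times> {..t})"
      by (auto simp: bad_def)
    show "finite {y. bad p y}" by (rule finite_subset[OF sub]) auto
    have "card {y. bad p y} \<le> card ({..t} \<times> {..t})"
      by (rule order.trans[OF card_mono[OF _ sub] card_image_le]) auto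
    then show "card {y. bad p y} < slot_count t"
      by (simp add: card_cartesian_product slot_count_def power2_eq_square)
  qed
  have "\<exists>g. bij_betw g (S c) (L c) \<and> (\<forall>p\<in>S c. \<not> bad p (g p))" if c: "c < 2" for c
  proof -
    have "\<exists>y\<in>L c. \<not> bad p y" for p
    proof (rule ccontr)
      assume "\<not> ?thesis"
      then have "L c \<subseteq> {y. bad p y}" by auto
      from card_mono[OF few(1) this] show False using few(2)[of p] card_L[OF c] card_SE[OF c] by simp
    qed
    then show ?thesis
      using matching_by_swaps[of "S c" "L c" bad] finSE(1)[of c] fin[OF c] card_L[OF c] uniq
      by (metis (no_types, lifting) L_def S_def finite_Diff mem_Collect_eq)
  qed
  then obtain g where g: "\<And>c. c < 2 \<Longrightarrow> bij_betw (g c) (S c) (L c)"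
      "\<And>c p. c < 2 \<Longrightarrow> p \<in> S c \<Longrightarrow> \<not> bad p (g c p)"
    by metis
  define h where "h i = (if i \<in> P then g (i mod 2) i else f i)" for i
  have h_bij: "bij_betw h (E c) (A c)" if "c < 2" for c
  proof -
    have "bij_betw h (S c) (L c)"
      using g(1)[OF that] by (rule bij_betw_cong[THEN iffD1, rotated]) (auto simp: h_def S_def)
    moreover have "bij_betw h (E c - S c) (f ` (E c - S c))"
      using inj_on_imp_bij_betw[OF inj]
      by (rule bij_betw_cong[THEN iffD1, rotated]) (auto simp: h_def S_def E_def)
    ultimately have "bij_betw h (S c \<union> (E c - S c)) (L c \<union> f ` (E c - S c))"
      by (rule bij_betw_combine) (auto simp: L_def)
    moreover have "S c \<union> (E c - S c) = E c" "L c \<union> f ` (E c - S c) = A c"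
      using SE[of c] fA[of c] unfolding L_def by blast+
    ultimately show ?thesis by simp
  qed
  have hA: "h i \<in> A (i mod 2)" if "i < 2 * n" for i
    using bij_betw_apply[OF h_bij[of "i mod 2"], of i] that by (simp add: E_def)
  have hG: "range h \<subseteq> carrier G"
  proof -
    have "h i \<in> carrier G" for i
      using hA[of i] sub[of "i mod 2"] bnd(2)[of i] f(1) by (cases "i \<in> P") (auto simp: h_def)
    then show ?thesis by auto
  qed
  show ?thesis
  proof (intro exI[of _ h] conjI allI impI)
    show "range h \<subseteq> carrier G" by (rule hG)
    have "bij_betw h (E 0 \<union> E 1) (A 0 \<union> A 1)"
      using disj by (intro bij_betw_combine h_bij) auto
    moreover have "E 0 \<union> E 1 = {..<2 * n}" by (auto simp: E_def)
    ultimately show "bij_betw h {..<2 * n} (A 0 \<union> A 1)" by simp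
    show "h i \<in> A (i mod 2)" if "i < 2 * n" for i by (rule hA[OF that])
    show "seg_prod G h a l \<noteq> \<one>" if l: "0 < l" "l \<le> t" "a + l \<le> 2 * n" for a l
    proof (cases "\<exists>p\<in>P. a \<le> p \<and> p < a + l")
      case False
      then have "seg_prod G h a l = seg_prod G f a l" by (intro seg_prod_cong) (auto simp: h_def)
      \<comment> \<open>A window free of slots is controlled at its last position, with
        \<open>l - 1\<close> in the role of the offset.\<close>
      moreover have "a + l - 1 \<in> {..<2 * n} - P" using False l by auto
      ultimately show ?thesis using win[of "a + l - 1" "l - 1"] l by simp
    next
      case True
      \<comment> \<open>A window of length at most \<open>t\<close> meets no second slot, so its
        other entries come from \<open>f\<close>; a trivial product would make \<open>h p\<close> a
        hole value of \<open>f\<close>.\<close>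
      then obtain p where p: "p \<in> P" "a \<le> p" "p < a + l" by auto
      define i j where "i = p - a" and "j = a + l - Suc p"
      have ij: "i \<le> p" "a = p - i" "l = Suc (i + j)" using p by (auto simp: i_def j_def)
      show ?thesis
      proof
        assume "seg_prod G h a l = \<one>"
        then have "h p = hole_value G h p i j" using eq_hole_value[OF hG ij(1), of j] ij by simp
        also have "\<dots> = hole_value G f p i j"
        proof (rule hole_value_cong[OF _ ij(1)])
          fix q assume "p - i \<le> q" "q \<le> p + j" "q \<noteq> p"
          then have "q \<notin> P" using near_slot_not_slot[of p t _ q] p(1) ij l by (auto simp: P_def)
          then show "h q = f q" by (simp add: h_def)
        qed
        finally have hp: "h p = hole_value G f p i j" .
        show False
        proof (cases "(i, j) = (0, 0)")
          case True
          then show False using hp hA[OF bnd(2)[OF p(1)]] sub[of "p mod 2"] by (auto simp: hole_value_def)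
        next
          case False
          then have "bad p (h p)" using hp ij l unfolding bad_def by (intro exI[of _ i] exI[of _ j] conjI) auto
          then show False using g(2)[of "p mod 2" p] p(1) by (simp add: h_def S_def)
        qed
      qed
    qed
  qed
qed

section \<open>The semidirect product\<close>

lemma semidirect_Z2_action:
  assumes "group N" and hom: "\<phi> \<in> hom (integer_mod_group 2) (AutoGroup N)"
  shows "a \<in> {0, 1} \<Longrightarrow> \<phi> a \<in> hom N N"
    and "x \<in> carrier N \<Longrightarrow> \<phi> 0 x = x"
    and "x \<in> carrier N \<Longrightarrow> \<phi> 1 (\<phi> 1 x) = x"
proof -
  interpret N: group N by fact
  have auto: "\<phi> a \<in> auto N" if "a \<in> {0, 1}" for a
    using hom that by (auto simp: hom_def AutoGroup_def carrier_integer_mod_group)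
  then show "a \<in> {0, 1} \<Longrightarrow> \<phi> a \<in> hom N N" by (auto simp: auto_def)
  interpret h: group_hom "integer_mod_group 2" "AutoGroup N" \<phi>
    using hom N.AutoGroup by (auto simp: group_hom_def group_hom_axioms_def)
  have 0: "\<phi> 0 = (\<lambda>x\<in>carrier N. x)" using h.hom_one by (simp add: AutoGroup_def BijGroup_def)
  then show "x \<in> carrier N \<Longrightarrow> \<phi> 0 x = x" by simp
  have "\<phi> 0 = \<phi> 1 \<otimes>\<^bsub>AutoGroup N\<^esub> \<phi> 1"
    using hom_mult[OF hom, of 1 1] by (simp add: carrier_integer_mod_group)
  also have "\<dots> = compose (carrier N) (\<phi> 1) (\<phi> 1)"
    using auto[of 1] by (simp add: AutoGroup_def BijGroup_def auto_def)
  finally show "x \<in> carrier N \<Longrightarrow> \<phi> 1 (\<phi> 1 x) = x"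
    using 0 by (metis compose_eq restrict_apply')
qed

lemma carrier_integer_mod_group_2 [simp]: "carrier (integer_mod_group 2) = {0, 1}"
  by (auto simp: carrier_integer_mod_group)

lemma parity_cases:
  assumes "S \<subseteq> carrier (semidirect_Z2 N \<phi>)"
  shows "S = even_part S \<union> odd_part S"
  using assms by (auto simp: even_part_def odd_part_def semidirect_Z2_def)

text \<open>By cancellation, two partial products agree only if the window between them has trivial
  product. The threshold is explicit and the same for every element type.\<close>

lemma alternating_weak_sequencing_of_large:
  assumes "group N" "\<phi> \<in> hom (integer_mod_group 2) (AutoGroup N)"
    and S: "S \<subseteq> carrier (semidirect_Z2 N \<phi>) - {\<one>\<^bsub>semidirect_Z2 N \<phi>\<^esub>}"
    and bal: "balanced S" and large: "2 * Suc (arrangement_bound t) \<le> card S"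
  shows "\<exists>ys. weak_sequencing (semidirect_Z2 N \<phi>) t S ys \<and> alternating_parity ys"
proof -
  interpret G: group "semidirect_Z2 N \<phi>" by (rule group_semidirect_Z2[OF assms(1,2)])
  let ?G = "semidirect_Z2 N \<phi>"
  define n where "n = card S div 2"
  define A where "A c = (if c = 0 then even_part S else odd_part S)" for c :: nat
  have A: "A 0 \<subseteq> carrier ?G - {\<one>\<^bsub>?G\<^esub>}" "A 1 \<subseteq> carrier ?G - {\<one>\<^bsub>?G\<^esub>}"
    "card (A 0) = n" "card (A 1) = n" "A 0 \<inter> A 1 = {}" "arrangement_bound t < n"
  proof -
    show "A 0 \<subseteq> carrier ?G - {\<one>\<^bsub>?G\<^esub>}" "A 1 \<subseteq> carrier ?G - {\<one>\<^bsub>?G\<^esub>}"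
      using S by (auto simp: A_def even_part_def odd_part_def)
    show "A 0 \<inter> A 1 = {}" by (auto simp: A_def even_part_def odd_part_def)
    show "card (A 0) = n" "card (A 1) = n" using bal by (simp_all add: A_def balanced_def n_def)
    show "arrangement_bound t < n" using large by (simp add: n_def)
  qed
  obtain h where h: "range h \<subseteq> carrier ?G" "bij_betw h {..<2 * n} (A 0 \<union> A 1)"
      "\<forall>i<2 * n. h i \<in> A (i mod 2)"
      "\<forall>a l. 0 < l \<longrightarrow> l \<le> t \<longrightarrow> a + l \<le> 2 * n \<longrightarrow> seg_prod ?G h a l \<noteq> \<one>\<^bsub>?G\<^esub>"
    using G.alternating_arrangement[OF A] by (elim exE conjE) (rule that)
  define ys where "ys = map h [0..<2 * n]"
  have "A 0 \<union> A 1 = S" using parity_cases[of S N \<phi>] S by (auto simp: A_def)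
  then have dist: "distinct ys" "set ys = S"
    using h(2) by (auto simp: ys_def distinct_map bij_betw_def atLeast0LessThan)
  have less: "partial_prod ?G ys i \<noteq> partial_prod ?G ys j" if "i < j" "j \<le> 2 * n" "j \<le> i + t" for i j
  proof -
    have "partial_prod ?G ys j = seg_prod ?G h 0 (i + (j - i))"
      using that by (simp add: ys_def partial_prod_map_upt)
    also have "\<dots> = partial_prod ?G ys i \<otimes>\<^bsub>?G\<^esub> seg_prod ?G h i (j - i)"
      unfolding G.seg_prod_add[OF h(1)] using that by (simp add: ys_def partial_prod_map_upt)
    finally have "partial_prod ?G ys j = partial_prod ?G ys i \<otimes>\<^bsub>?G\<^esub> seg_prod ?G h i (j - i)" .
    moreover have "seg_prod ?G h i (j - i) \<noteq> \<one>\<^bsub>?G\<^esub>" using that h(4) by simp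
    moreover have "partial_prod ?G ys i \<in> carrier ?G"
      using h(1) that by (simp add: ys_def partial_prod_map_upt)
    ultimately show ?thesis using h(1) by (metis G.l_cancel_one' G.seg_prod_closed)
  qed
  have "weak_sequencing ?G t S ys"
    unfolding weak_sequencing_def
  proof (intro conjI allI impI)
    fix i j
    assume "i \<le> length ys" "j \<le> length ys" "1 \<le> \<bar>int i - int j\<bar>" "\<bar>int i - int j\<bar> \<le> int t"
    then show "partial_prod ?G ys i \<noteq> partial_prod ?G ys j"
      using less[of i j] less[of j i] by (cases i j rule: linorder_cases) (auto simp: ys_def)
  qed (use dist in auto)
  moreover have "alternating_parity ys"
  proof -
    have "snd (h i) = int (i mod 2)" if "i < 2 * n" for i
      using h(3) that by (auto simp: A_def even_part_def odd_part_def split: if_splits)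
    then show ?thesis by (auto simp: alternating_parity_def ys_def mod_Suc)
  qed
  ultimately show ?thesis by blast
qed

text \<open>The explicit threshold witnesses that a bound exists, so the chosen number has the
  property by which it was chosen.\<close>

lemma sequencing_bound_nat:
  fixes N :: "nat monoid"
  assumes "group N" "\<phi> \<in> hom (integer_mod_group 2) (AutoGroup N)"
    and "S \<subseteq> carrier (semidirect_Z2 N \<phi>) - {\<one>\<^bsub>semidirect_Z2 N \<phi>\<^esub>}"
    and "balanced S" "sequencing_bound t \<le> card S"
  shows "\<exists>ys. weak_sequencing (semidirect_Z2 N \<phi>) t S ys \<and> alternating_parity ys"
proof -
  have "\<exists>K. \<forall>(N :: nat monoid) \<phi> S.
       group N \<longrightarrow> \<phi> \<in> hom (integer_mod_group 2) (AutoGroup N) \<longrightarrow>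
       S \<subseteq> carrier (semidirect_Z2 N \<phi>) - {\<one>\<^bsub>semidirect_Z2 N \<phi>\<^esub>} \<longrightarrow>
       balanced S \<longrightarrow> K \<le> card S \<longrightarrow>
       (\<exists>ys. weak_sequencing (semidirect_Z2 N \<phi>) t S ys \<and> alternating_parity ys)"
    using alternating_weak_sequencing_of_large by blast
  from someI_ex[OF this, folded sequencing_bound_def] show ?thesis using assms by blast
qed

section \<open>Transfer to groups on the natural numbers\<close>

text \<open>Every generated element is the product of a word over \<open>H\<close> and its inverses,
  and there are only countably many such words.\<close>

lemma (in group) countable_generate:
  assumes "countable H" "H \<subseteq> carrier G"
  shows "countable (generate G H)"
proof -
  let ?prod = "\<lambda>ws. foldr (\<otimes>) ws \<one>"
  have closed: "?prod us \<in> carrier G" if "set us \<subseteq> carrier G" for us using that by (induction us) auto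
  have app: "?prod (us @ vs) = ?prod us \<otimes> ?prod vs"
    if "set us \<subseteq> carrier G" "set vs \<subseteq> carrier G" for us vs
    using that by (induction us) (auto simp: closed m_assoc)
  let ?H = "H \<union> m_inv G ` H"
  have H: "?H \<subseteq> carrier G" using assms(2) by auto
  have "x \<in> ?prod ` lists ?H" if "x \<in> generate G H" for x
    using that
  proof induction
    case one
    then show ?case by (intro image_eqI[of _ _ "[]"]) auto
  next
    case (incl h)
    then show ?case using assms(2) by (intro image_eqI[of _ _ "[h]"]) auto
  next
    case (inv h)
    then show ?case using assms(2) by (intro image_eqI[of _ _ "[inv h]"]) auto
  next
    case (eng u v)
    then obtain us vs where uv: "us \<in> lists ?H" "u = ?prod us" "vs \<in> lists ?H" "v = ?prod vs" by blast
    then have sub: "set us \<subseteq> carrier G" "set vs \<subseteq> carrier G" using H by blast+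
    have "u \<otimes> v = ?prod (us @ vs)" unfolding uv(2,4) by (rule app[OF sub, symmetric])
    moreover have "us @ vs \<in> lists ?H" using uv(1,3) by simp
    ultimately show ?case by (rule image_eqI)
  qed
  then have "generate G H \<subseteq> ?prod ` lists ?H" by (rule subsetI)
  moreover have "countable (?prod ` lists ?H)"
    using assms(1) by (intro countable_image countable_lists countable_Un)
  ultimately show ?thesis by (rule countable_subset)
qed

text \<open>A homomorphism maps partial products to partial products, and injectivity on the carrier
  keeps distinct ones distinct.\<close>

lemma weak_sequencing_hom_image:
  assumes "monoid G" and h: "h \<in> hom G G'" "h \<one>\<^bsub>G\<^esub> = \<one>\<^bsub>G'\<^esub>" "inj_on h (carrier G)"
    and ys: "weak_sequencing G t S ys" and S: "S \<subseteq> carrier G"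
  shows "weak_sequencing G' t (h ` S) (map h ys)"
proof -
  interpret monoid G by fact
  have set: "set ys = S" "distinct ys" using ys by (auto simp: weak_sequencing_def)
  have *: "partial_prod G ys i \<in> carrier G \<and> partial_prod G' (map h ys) i = h (partial_prod G ys i)"
    if "i \<le> length ys" for i
    using that
  proof (induction i)
    case 0
    then show ?case by (simp add: partial_prod_def h)
  next
    case (Suc i)
    moreover have "ys ! i \<in> carrier G" using Suc.prems set(1) S by auto
    ultimately show ?case
      using hom_mult[OF h(1)] by (simp add: partial_prod_def take_Suc_conv_app_nth)
  qed
  show ?thesis
    unfolding weak_sequencing_def
  proof (intro conjI allI impI)
    show "distinct (map h ys)" "set (map h ys) = h ` S"
      using set inj_on_subset[OF h(3) S] by (auto simp: distinct_map)
    fix i j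
    assume ij: "i \<le> length (map h ys)" "j \<le> length (map h ys)"
      "1 \<le> \<bar>int i - int j\<bar>" "\<bar>int i - int j\<bar> \<le> int t"
    then have "partial_prod G ys i \<noteq> partial_prod G ys j"
      using ys unfolding weak_sequencing_def length_map by blast
    then show "partial_prod G' (map h ys) i \<noteq> partial_prod G' (map h ys) j"
      using *[of i] *[of j] ij inj_onD[OF h(3)] by auto
  qed
qed

text \<open>The chosen bound might lie below the explicit threshold and is characterised by groups
  on \<open>nat\<close> only. Hence \<open>S\<close> is moved into such a group, sequenced there and
  moved back.\<close>

theorem theorem1p3:
  fixes t :: nat and N :: "'a monoid" and \<phi> :: "int \<Rightarrow> 'a \<Rightarrow> 'a" and S :: "('a \<times> int) set"
  assumes "t > 0"
    and "group N"
    and "\<phi> \<in> hom (integer_mod_group 2) (AutoGroup N)"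
    and "S \<subseteq> carrier (semidirect_Z2 N \<phi>) - {\<one>\<^bsub>semidirect_Z2 N \<phi>\<^esub>}"
    and "balanced S"
    and "card S \<ge> sequencing_bound t"
  shows "\<exists>ys. weak_sequencing (semidirect_Z2 N \<phi>) t S ys \<and> alternating_parity ys"
proof -

  \<comment> \<open>A countable subgroup invariant under the action\<close>
  interpret N: group N by fact
  note act = semidirect_Z2_action[OF assms(2,3)]
  have finS: "finite S" using assms(5) by (simp add: balanced_def)
  have S: "fst g \<in> carrier N" "snd g \<in> {0, 1}" "g \<noteq> (\<one>\<^bsub>N\<^esub>, 0)" if "g \<in> S" for g
    using assms(4) that by (auto simp: semidirect_Z2_def)
  \<comment> \<open>Adding the image under \<open>\<phi> 1\<close> makes the generating set
    invariant, as \<open>\<phi> 1\<close> is an involution; the generated subgroup inherits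
    this.\<close>
  define H where "H = fst ` S \<union> \<phi> 1 ` fst ` S"
  have H: "H \<subseteq> carrier N" "countable H"
    using S(1) hom_in_carrier[OF act(1)[of 1]] countable_finite[OF finS] by (auto simp: H_def)
  have "\<phi> 1 ` \<phi> 1 ` fst ` S = fst ` S"
    using S(1) act(3) by (simp add: image_image)
  then have \<phi>H: "\<phi> 1 ` H \<subseteq> H" by (auto simp: H_def image_Un)
  define M where "M = generate N H"
  have "subgroup M N" unfolding M_def by (rule N.generate_is_subgroup[OF H(1)])
  then interpret M: subgroup M N .
  have M_action: "\<phi> a x \<in> M" if "a \<in> {0, 1}" "x \<in> M" for a x
  proof -
    interpret h: group_hom N N "\<phi> 1"
      using act(1)[of 1] by unfold_locales auto
    have "\<phi> 1 ` M \<subseteq> M"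
      unfolding M_def h.generate_img[OF H(1), symmetric] by (rule N.mono_generate[OF \<phi>H])
    then show ?thesis using that act(2)[of x] M.mem_carrier by auto
  qed
  have SM: "fst g \<in> M" if "g \<in> S" for g
    using that by (auto simp: M_def H_def intro: generate.incl)

  \<comment> \<open>A copy of this subgroup on the natural numbers\<close>
  define e where "e = to_nat_on M"
  define r where "r = inv_into M e"
  have "inj_on e M" unfolding e_def M_def by (intro inj_on_to_nat_on N.countable_generate H)
  then have re [simp]: "r (e x) = x" if "x \<in> M" for x using that by (simp add: r_def)
  define N' :: "nat monoid" where
    "N' = \<lparr>carrier = e ` M, monoid.mult = (\<lambda>x y. e (r x \<otimes>\<^bsub>N\<^esub> r y)), one = e \<one>\<^bsub>N\<^esub>\<rparr>"
  have N'_simps [simp]: "carrier N' = e ` M" "\<one>\<^bsub>N'\<^esub> = e \<one>\<^bsub>N\<^esub>" by (simp_all add: N'_def)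
  have mult_N' [simp]: "e x \<otimes>\<^bsub>N'\<^esub> e y = e (x \<otimes>\<^bsub>N\<^esub> y)" if "x \<in> M" "y \<in> M" for x y
    using that by (simp add: N'_def)
  have "group N'"
  proof (rule groupI)
    fix x assume "x \<in> carrier N'"
    then obtain x' where "x' \<in> M" "x = e x'" by auto
    then show "\<exists>y\<in>carrier N'. y \<otimes>\<^bsub>N'\<^esub> x = \<one>\<^bsub>N'\<^esub>"
      by (intro bexI[of _ "e (inv\<^bsub>N\<^esub> x')"]) auto
  qed (auto simp: N.m_assoc)
  define \<phi>' where "\<phi>' a = (\<lambda>x\<in>e ` M. e (\<phi> a (r x)))" for a
  have \<phi>'_e [simp]: "\<phi>' a (e x) = e (\<phi> a x)" if "x \<in> M" for a x using that by (simp add: \<phi>'_def)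
  have \<phi>'_auto: "\<phi>' a \<in> auto N'" if a: "a \<in> {0, 1}" for a
  proof -
    have "\<phi>' a (\<phi>' a x) = x" "\<phi>' a x \<in> e ` M" if "x \<in> e ` M" for x
      using that a act(2,3) M_action[OF a] M.mem_carrier by auto
    \<comment> \<open>Each \<open>\<phi>' a\<close> is its own inverse on the carrier: the identity
      for 0, an involution for 1.\<close>
    then have "bij_betw (\<phi>' a) (e ` M) (e ` M)"
      by (intro bij_betw_byWitness[of _ "\<phi>' a"]) auto
    moreover have "\<phi>' a \<in> extensional (e ` M)" by (simp add: \<phi>'_def)
    moreover have "\<phi>' a \<in> hom N' N'"
      using M_action[OF a] hom_mult[OF act(1)[OF a]] by (intro homI) (auto simp: M.mem_carrier)
    ultimately show ?thesis by (simp add: auto_def Bij_def)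
  qed
  have hom': "\<phi>' \<in> hom (integer_mod_group 2) (AutoGroup N')"
  proof (rule homI)
    fix a assume "a \<in> carrier (integer_mod_group 2)"
    then show "\<phi>' a \<in> carrier (AutoGroup N')" using \<phi>'_auto by (simp add: AutoGroup_def)
  next
    fix a b assume "a \<in> carrier (integer_mod_group 2)" "b \<in> carrier (integer_mod_group 2)"
    then have ab: "a \<in> {0, 1}" "b \<in> {0, 1}" by auto
    have "\<phi>' a \<otimes>\<^bsub>AutoGroup N'\<^esub> \<phi>' b = compose (e ` M) (\<phi>' a) (\<phi>' b)"
      using \<phi>'_auto[OF ab(1)] \<phi>'_auto[OF ab(2)] by (simp add: AutoGroup_def BijGroup_def auto_def)
    also have "\<dots> = \<phi>' (a \<otimes>\<^bsub>integer_mod_group 2\<^esub> b)"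
    proof (rule extensionalityI)
      fix x assume "x \<in> e ` M"
      then obtain x' where "x' \<in> M" "x = e x'" by auto
      then show "compose (e ` M) (\<phi>' a) (\<phi>' b) x = \<phi>' (a \<otimes>\<^bsub>integer_mod_group 2\<^esub> b) x"
        using ab act(2,3) M_action M.mem_carrier by (auto simp: compose_eq)
    qed (simp_all add: \<phi>'_def)
    finally show "\<phi>' (a \<otimes>\<^bsub>integer_mod_group 2\<^esub> b) = \<phi>' a \<otimes>\<^bsub>AutoGroup N'\<^esub> \<phi>' b" by simp
  qed

  \<comment> \<open>Transport of the set to the copy and of its sequencing back\<close>
  let ?G = "semidirect_Z2 N \<phi>" and ?G' = "semidirect_Z2 N' \<phi>'"
  have G': "carrier ?G' = e ` M \<times> {0, 1}" "\<one>\<^bsub>?G'\<^esub> = (e \<one>\<^bsub>N\<^esub>, 0)" by (auto simp: semidirect_Z2_def)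
  have G: "carrier ?G = carrier N \<times> {0, 1}" "\<one>\<^bsub>?G\<^esub> = (\<one>\<^bsub>N\<^esub>, 0)" by (auto simp: semidirect_Z2_def)
  define S' where "S' = map_prod e id ` S"
  have S'_sub: "S' \<subseteq> carrier ?G' - {\<one>\<^bsub>?G'\<^esub>}"
  proof
    fix g assume "g \<in> S'"
    then obtain x a where xa: "(x, a) \<in> S" "g = (e x, a)" by (auto simp: S'_def)
    then have "x \<in> M" "a \<in> {0, 1}" "(x, a) \<noteq> (\<one>\<^bsub>N\<^esub>, 0)" using SM[OF xa(1)] S[OF xa(1)] by auto
    then show "g \<in> carrier ?G' - {\<one>\<^bsub>?G'\<^esub>}"
      using xa(2) inj_onD[OF \<open>inj_on e M\<close>, of x "\<one>\<^bsub>N\<^esub>"] by (auto simp: G')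
  qed
  have inj: "inj_on (map_prod e id) S"
  proof (rule inj_onI)
    fix g g' assume "g \<in> S" "g' \<in> S" "map_prod e id g = map_prod e id g'"
    then show "g = g'"
      using SM[of g] SM[of g'] inj_onD[OF \<open>inj_on e M\<close>, of "fst g" "fst g'"] by (auto simp: prod_eq_iff)
  qed
  have card_eq: "card (map_prod e id ` T) = card T" if "T \<subseteq> S" for T
    by (rule card_image[OF inj_on_subset[OF inj that]])
  have "even_part S' = map_prod e id ` even_part S" "odd_part S' = map_prod e id ` odd_part S"
    by (auto simp: S'_def even_part_def odd_part_def)
  then have "balanced S'" "card S' = card S"
    using assms(5) card_eq[of "even_part S"] card_eq[of "odd_part S"] card_eq[of S]
    by (auto simp: balanced_def S'_def even_part_def odd_part_def)
  then obtain ys where ys: "weak_sequencing ?G' t S' ys" "alternating_parity ys"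
    using sequencing_bound_nat[OF \<open>group N'\<close> hom' S'_sub, of t] assms(6) by auto

  \<comment> \<open>Decoding by \<open>r\<close> embeds the copy into the original semidirect
    product and sends \<open>S'\<close> back to \<open>S\<close>; second components, hence parities,
    are unchanged.\<close>
  let ?h = "map_prod r id :: nat \<times> int \<Rightarrow> 'a \<times> int"
  have "weak_sequencing ?G t (?h ` S') (map ?h ys)"
  proof (rule weak_sequencing_hom_image[OF _ _ _ _ ys(1)])
    show "monoid ?G'" using group_semidirect_Z2[OF \<open>group N'\<close> hom'] by (rule group.axioms)
    show "?h \<in> hom ?G' ?G"
    proof (rule homI)
      fix g g' assume "g \<in> carrier ?G'" "g' \<in> carrier ?G'"
      then obtain x a y b where *: "g = (e x, a)" "g' = (e y, b)" "x \<in> M" "y \<in> M" "a \<in> {0, 1}" "b \<in> {0, 1}"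
        by (auto simp: G')
      then show "?h (g \<otimes>\<^bsub>?G'\<^esub> g') = ?h g \<otimes>\<^bsub>?G\<^esub> ?h g'"
        using M_action[of a y] by (simp add: semidirect_Z2_def)
    qed (auto simp: G G' M.mem_carrier)
    show "inj_on ?h (carrier ?G')" by (rule inj_onI) (auto simp: G')
    show "?h \<one>\<^bsub>?G'\<^esub> = \<one>\<^bsub>?G\<^esub>" by (simp add: G G')
  qed (use S'_sub in auto)
  moreover have "?h ` S' = S"
    using SM by (force simp: S'_def image_image)
  moreover have "alternating_parity (map ?h ys)" using ys(2) by (simp add: alternating_parity_def)
  ultimately show ?thesis by metis
qed

end
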